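(* Let $f(x)\sim\sum_{n\ge0}(-1)^na_nx^{-n-1}$ as $x\to\infty$, with $a_0\ne0$, and let $(R_n)$ be the Appell sequence generated by $(a_n)$. Fix $\alpha\in\mathbb R$ and $\delta\ge0$, both independent of $x$, and put $\beta=-\delta^2\le0$. For the symmetric pair $x+\alpha\pm\delta$ define \[ \nabla_m(\alpha,\beta):=\frac{R_{m+1}(\alpha+\delta)-R_{m+1}(\alpha-\delta)}{2(m+1)\delta}, \] with the value at $\delta=0$ understood by continuity. Then \[ \frac{f(x+\alpha+\delta)-f(x+\alpha-\delta)}{2\delta}\sim-\sum_{m\ge0}(-1)^m\frac{(m+1)\,\nabla_m(\alpha,\beta)}{x^{m+2}}, \] where \[ \nabla_m(\alpha,\beta)=\sum_{i=0}^{\lfloor m/2\rfloor}\frac1{2i+1}\binom m{2i}(-\beta)^iR_{m-2i}(\alpha). \] The symmetric second difference has the expansion \[ f(x+\alpha+\delta)-2f(x+\alpha)+f(x+\alpha-\delta)\sim\sum_{n\ge2}(-1)^n\frac{\Delta_n(\alpha,\beta)}{x^{n+1}}, \] with \[ \Delta_n(\alpha,\beta)=2\sum_{i=1}^{\lfloor n/2\rfloor}\binom n{2i}(-\beta)^iR_{n-2i}(\alpha). \] Here $\nabla_m$ is defined for $m\ge0$ and $\Delta_n$ for $n\ge0$, with $\Delta_0=\Delta_1=0$ (empty sums). For fixed $\beta$, both satisfy the Appell lowering relation \[ \partial_\alpha\nabla_m=m\nabla_{m-1}\ \ (m\ge1),\qquad\partial_\alpha\Delta_n=n\Delta_{n-1}\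 \ (n\ge1). \]
   Context: The Appell sequence generated by $(a_n)$ (with $a_0\ne0$) is $R_n(t)=\sum_{k=0}^n\binom nk a_kt^{n-k}$; it satisfies $R_n'=nR_{n-1}$ and $R_n(0)=a_n$. All expansions are asymptotic expansions as $x\to\infty$: $g(x)\sim\sum_{n\ge n_0}c_nx^{-n-1}$ means $g(x)=\sum_{n=n_0}^Nc_nx^{-n-1}+o(x^{-N-1})$ for every $N\ge n_0$.
   Formalization: The expansion of the symmetric difference quotient of f is stated only for δ > 0, since at δ = 0 its left side is 0/0 (and the derivative reading fails, e.g. f(x) = 1/x + e^{-x} sin(e^{2x})); all other claims cover every δ ≥ 0. *)

theory Defs
  imports Complex_Main "HOL-Library.Landau_Symbols"
begin

definition asymp_expansion :: "(real \<Rightarrow> real) \<Rightarrow> nat \<Rightarrow> (nat \<Rightarrow> real) \<Rightarrow> bool" where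
  "asymp_expansion g n\<^sub>0 c \<longleftrightarrow>
     (\<forall>N\<ge>n\<^sub>0. (\<lambda>x. g x - (\<Sum>n=n\<^sub>0..N. c n / x ^ (n + 1))) \<in> o[at_top](\<lambda>x. 1 / x ^ (N + 1)))"

definition appell :: "(nat \<Rightarrow> real) \<Rightarrow> nat \<Rightarrow> real \<Rightarrow> real" where
  "appell a n t = (\<Sum>k=0..n. real (n choose k) * a k * t ^ (n - k))"

definition appell_quot :: "(nat \<Rightarrow> real) \<Rightarrow> nat \<Rightarrow> real \<Rightarrow> real \<Rightarrow> real" where
  "appell_quot a m \<alpha> \<delta> =
     (appell a (m + 1) (\<alpha> + \<delta>) - appell a (m + 1) (\<alpha> - \<delta>)) / (2 * (real m + 1) * \<delta>)"

text \<open>The second parameter is \<open>\<beta> = - \<delta>\<^sup>2 \<le> 0\<close>, so \<open>\<delta> = sqrt (- \<beta>)\<close>; the value at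
  \<open>\<delta> = 0\<close> is the limit of the quotients. For \<open>\<beta> > 0\<close> the value has no meaning.\<close>

definition nabla :: "(nat \<Rightarrow> real) \<Rightarrow> nat \<Rightarrow> real \<Rightarrow> real \<Rightarrow> real" where
  "nabla a m \<alpha> \<beta> =
     (if \<beta> = 0 then Lim (at_right 0) (\<lambda>\<delta>. appell_quot a m \<alpha> \<delta>)
      else appell_quot a m \<alpha> (sqrt (- \<beta>)))"

definition Delta :: "(nat \<Rightarrow> real) \<Rightarrow> nat \<Rightarrow> real \<Rightarrow> real \<Rightarrow> real" where
  "Delta a n \<alpha> \<beta> =
     2 * (\<Sum>i=1..n div 2. real (n choose (2 * i)) * (- \<beta>) ^ i * appell a (n - 2 * i) \<alpha>)"

lemma nabla_pos:
  assumes "\<delta> > 0"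
  shows "nabla a m \<alpha> (- \<delta>\<^sup>2) =
    (appell a (m + 1) (\<alpha> + \<delta>) - appell a (m + 1) (\<alpha> - \<delta>)) / (2 * (real m + 1) * \<delta>)"
  using assms by (simp add: nabla_def appell_quot_def)

text \<open>The limit in the definition of \<^const>\<open>nabla\<close> exists.\<close>

lemma nabla_zero: "((\<lambda>\<delta>. appell_quot a m \<alpha> \<delta>) \<longlongrightarrow> nabla a m \<alpha> 0) (at_right 0)"
proof -
  define D where "D = (\<Sum>k=0..m+1. real ((m + 1) choose k) * a k * (real (m + 1 - k) * \<alpha> ^ (m - k)))"
  have R: "(appell a (m + 1) has_real_derivative D) (at \<alpha>)"
    unfolding appell_def[abs_def] D_def
    by (auto intro!: derivative_eq_intros sum.cong)
  have R2: "((\<lambda>h. appell a (m + 1) (\<alpha> + h) - appell a (m + 1) (\<alpha> - h)) has_real_derivative 2 * D) (at 0)"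
  proof -
    have "((\<lambda>h. appell a (m + 1) (\<alpha> + h)) has_real_derivative D * 1) (at 0)"
      by (rule DERIV_chain2[where f = "appell a (m + 1)"])
         (use R in \<open>auto intro!: derivative_eq_intros\<close>)
    moreover have "((\<lambda>h. appell a (m + 1) (\<alpha> - h)) has_real_derivative D * (- 1)) (at 0)"
      by (rule DERIV_chain2[where f = "appell a (m + 1)"])
         (use R in \<open>auto intro!: derivative_eq_intros\<close>)
    ultimately show ?thesis
      by (rule DERIV_cong[OF DERIV_diff]) simp
  qed
  have "((\<lambda>h. (appell a (m + 1) (\<alpha> + h) - appell a (m + 1) (\<alpha> - h)) / h) \<longlongrightarrow> 2 * D) (at 0)"
    using R2 by (simp add: DERIV_def)
  then have "((\<lambda>h. (appell a (m + 1) (\<alpha> + h) - appell a (m + 1) (\<alpha> - h)) / h / (2 * (real m + 1)))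
      \<longlongrightarrow> 2 * D / (2 * (real m + 1))) (at_right 0)"
    by (intro tendsto_divide tendsto_const) (auto intro: tendsto_within_subset)
  then have L: "((\<lambda>\<delta>. appell_quot a m \<alpha> \<delta>) \<longlongrightarrow> 2 * D / (2 * (real m + 1))) (at_right 0)"
    by (simp add: appell_quot_def[abs_def] mult.commute)
  then have "nabla a m \<alpha> 0 = 2 * D / (2 * (real m + 1))"
    by (simp add: nabla_def tendsto_Lim)
  with L show ?thesis by simp
qed

end

theory Submission
  imports Defs
begin

text \<open>
  Expanding each \<open>(x + t) ^ (- n - 1)\<close> in powers of \<open>1 / x\<close> shows that replacing \<open>f x\<close> by
  \<open>f (x + t)\<close> replaces the coefficients \<open>a n = R n 0\<close> by \<open>R n t\<close>. Both difference expansions are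
  then linear combinations of shifted expansions, and the closed forms are the odd and even parts
  in \<open>\<delta>\<close> of the Appell addition formula \<open>R n (\<alpha> + \<delta>) = (\<Sum>j\<le>n. (n choose j) * \<delta> ^ j * R (n - j) \<alpha>)\<close>.
\<close>

subsection \<open>Asymptotic expansions\<close>

lemma asymp_expansion_lincomb:
  assumes "asymp_expansion g n\<^sub>0 c" "asymp_expansion h n\<^sub>0 d"
  shows "asymp_expansion (\<lambda>x. u * g x + v * h x) n\<^sub>0 (\<lambda>n. u * c n + v * d n)"
  unfolding asymp_expansion_def
proof (intro allI impI)
  fix N assume N: "N \<ge> n\<^sub>0"
  let ?S = "\<lambda>c x. \<Sum>n=n\<^sub>0..N. c n / x ^ (n + 1)"
  have "(\<lambda>x. u * (g x - ?S c x)) \<in> o[at_top](\<lambda>x. 1 / x ^ (N + 1))"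
    "(\<lambda>x. v * (h x - ?S d x)) \<in> o[at_top](\<lambda>x. 1 / x ^ (N + 1))"
    using assms N by (auto simp: asymp_expansion_def)
  then have "(\<lambda>x. u * (g x - ?S c x) + v * (h x - ?S d x)) \<in> o[at_top](\<lambda>x. 1 / x ^ (N + 1))"
    by (rule sum_in_smallo)
  moreover have "u * (g x - ?S c x) + v * (h x - ?S d x)
      = u * g x + v * h x - ?S (\<lambda>n. u * c n + v * d n) x" for x
    by (simp add: algebra_simps sum.distrib sum_distrib_left add_divide_distrib)
  ultimately show "(\<lambda>x. u * g x + v * h x - ?S (\<lambda>n. u * c n + v * d n) x)
      \<in> o[at_top](\<lambda>x. 1 / x ^ (N + 1))"
    by simp
qed

lemma asymp_expansion_drop_zeros:
  assumes "asymp_expansion g 0 c" "\<And>n. n < n\<^sub>0 \<Longrightarrow> c n = 0"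
  shows "asymp_expansion g n\<^sub>0 c"
  unfolding asymp_expansion_def
proof (intro allI impI)
  fix N assume "N \<ge> n\<^sub>0"
  have "(\<Sum>n=n\<^sub>0..N. c n / x ^ (n + 1)) = (\<Sum>n=0..N. c n / x ^ (n + 1))" for x :: real
    by (rule sum.mono_neutral_left) (use assms(2) in auto)
  then show "(\<lambda>x. g x - (\<Sum>n=n\<^sub>0..N. c n / x ^ (n + 1))) \<in> o[at_top](\<lambda>x. 1 / x ^ (N + 1))"
    using assms(1) by (simp add: asymp_expansion_def)
qed

lemma power_inverse_shift_taylor:
  fixes x t :: real
  assumes "x > \<bar>t\<bar>"
  shows "\<exists>s. \<bar>s\<bar> \<le> \<bar>t\<bar> \<and>
    1 / (x + t) ^ (n + 1) = (\<Sum>j<K. (-1) ^ j * real ((n + j) choose n) * t ^ j / x ^ (n + j + 1))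
      + (-1) ^ K * real ((n + K) choose n) * t ^ K / (x + s) ^ (n + K + 1)"
proof -
  define D where "D j s = (-1) ^ j * (fact (n + j) / fact n) / (x + s) ^ (n + j + 1)" for j and s :: real
  have D: "(D j has_real_derivative D (Suc j) s) (at s)" if "\<bar>s\<bar> \<le> \<bar>t\<bar>" for j s
  proof -
    have y: "x + s \<noteq> 0" using that assms by linarith
    have deriv: "((\<lambda>s. C / (x + s) ^ Suc k) has_real_derivative - (C * real (Suc k)) / (x + s) ^ Suc (Suc k)) (at s)"
      for C k
    proof -
      have "((\<lambda>s. (x + s) ^ Suc k) has_real_derivative real (Suc k) * (x + s) ^ k) (at s)"
        by (rule DERIV_cong[OF DERIV_power]) (auto intro!: derivative_eq_intros)
      from DERIV_divide[OF DERIV_const this] show ?thesis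
        by (rule DERIV_cong) (use y in \<open>simp_all add: divide_simps del: of_nat_Suc\<close>)
    qed
    have "- ((-1) ^ j * (fact (n + j) / fact n) * real (Suc (n + j))) / (x + s) ^ Suc (Suc (n + j)) = D (Suc j) s"
      by (simp add: D_def)
    from DERIV_cong[OF deriv this] show ?thesis
      by (simp add: D_def[abs_def])
  qed
  have "\<exists>s. \<bar>s\<bar> \<le> \<bar>t\<bar> \<and> D 0 t = (\<Sum>m<K. D m 0 / fact m * t ^ m) + D K s / fact K * t ^ K"
    by (rule Maclaurin_bi_le) (use D in auto)
  moreover have "D j s / fact j * t ^ j
      = (-1) ^ j * real ((n + j) choose n) * t ^ j / (x + s) ^ (n + j + 1)" for j s
    by (simp add: D_def binomial_fact field_simps)
  moreover have "D 0 t = 1 / (x + t) ^ (n + 1)"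
    by (simp add: D_def)
  ultimately show ?thesis
    by (simp only: add_0_right)
qed

lemma inverse_shift_bigo:
  fixes t :: real
  assumes "k \<le> m"
  shows "(\<lambda>x. 1 / (x - t) ^ m) \<in> O[at_top](\<lambda>x. 1 / x ^ k)"
proof (rule bigoI)
  show "\<forall>\<^sub>F x in at_top. norm (1 / (x - t) ^ m) \<le> 2 ^ m * norm (1 / x ^ k)"
    using eventually_ge_at_top[of "max 1 (2 * \<bar>t\<bar>)"]
  proof eventually_elim
    case (elim x)
    then have x: "x \<ge> 1" "x / 2 \<le> x - t" "x > 0" by auto
    have "x ^ k \<le> x ^ m" by (rule power_increasing) (use x assms in auto)
    also have "\<dots> = 2 ^ m * (x / 2) ^ m" by (simp add: power_divide)
    also have "\<dots> \<le> 2 ^ m * (x - t) ^ m"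
      by (intro mult_left_mono power_mono) (use x in auto)
    finally have *: "x ^ k \<le> 2 ^ m * (x - t) ^ m" .
    have "0 < x - t" using x by linarith
    then show ?case using * x by (simp add: field_simps)
  qed
qed

lemma inverse_power_smallo:
  assumes "k < m"
  shows "(\<lambda>x::real. 1 / x ^ m) \<in> o[at_top](\<lambda>x. 1 / x ^ k)"
proof (rule smalloI_tendsto)
  have "((\<lambda>x::real. inverse (x ^ (m - k))) \<longlongrightarrow> 0) at_top"
    by (intro tendsto_inverse_0_at_top filterlim_pow_at_top filterlim_ident) (use assms in auto)
  moreover have "\<forall>\<^sub>F x::real in at_top. inverse (x ^ (m - k)) = (1 / x ^ m) / (1 / x ^ k)"
    using eventually_gt_at_top[of 0]
    by eventually_elim (use assms in \<open>simp add: field_simps flip: power_add\<close>)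
  ultimately show "((\<lambda>x::real. (1 / x ^ m) / (1 / x ^ k)) \<longlongrightarrow> 0) at_top"
    by (rule Lim_transform_eventually)
  show "\<forall>\<^sub>F x::real in at_top. 1 / x ^ k \<noteq> 0"
    using eventually_gt_at_top[of 0] by eventually_elim auto
qed

lemma power_inverse_shift_smallo:
  fixes t :: real
  assumes "n \<le> N"
  shows "(\<lambda>x. 1 / (x + t) ^ (n + 1)
      - (\<Sum>j\<le>N - n. (-1) ^ j * real ((n + j) choose n) * t ^ j / x ^ (n + j + 1)))
    \<in> o[at_top](\<lambda>x. 1 / x ^ (N + 1))"
proof -
  define K where "K = Suc (N - n)"
  define C where "C = real ((n + K) choose n) * \<bar>t\<bar> ^ K"
  let ?E = "\<lambda>x. 1 / (x + t) ^ (n + 1)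
      - (\<Sum>j<K. (-1) ^ j * real ((n + j) choose n) * t ^ j / x ^ (n + j + 1))"
  have "?E \<in> O[at_top](\<lambda>x. 1 / (x - \<bar>t\<bar>) ^ (N + 2))"
  proof (rule bigoI)
    show "\<forall>\<^sub>F x in at_top. norm (?E x) \<le> C * norm (1 / (x - \<bar>t\<bar>) ^ (N + 2))"
      using eventually_gt_at_top[of "\<bar>t\<bar>"]
    proof eventually_elim
      case (elim x)
      then obtain s where s: "\<bar>s\<bar> \<le> \<bar>t\<bar>"
        "?E x = (-1) ^ K * real ((n + K) choose n) * t ^ K / (x + s) ^ (n + K + 1)"
        using power_inverse_shift_taylor[of t x n K] by auto
      have nK: "n + K + 1 = N + 2" using assms by (simp add: K_def)
      have pos: "0 < x - \<bar>t\<bar>" "x - \<bar>t\<bar> \<le> x + s" using elim s by auto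
      have "norm (?E x) = C / \<bar>x + s\<bar> ^ (N + 2)"
        unfolding s(2) nK by (simp add: C_def abs_mult power_abs)
      also have "\<bar>x + s\<bar> = x + s" using pos by simp
      also have "C / (x + s) ^ (N + 2) \<le> C / (x - \<bar>t\<bar>) ^ (N + 2)"
        by (intro divide_left_mono power_mono mult_pos_pos zero_less_power) (use pos in \<open>auto simp: C_def\<close>)
      also have "\<dots> = C * norm (1 / (x - \<bar>t\<bar>) ^ (N + 2))" using pos by simp
      finally show ?case .
    qed
  qed
  also have "(\<lambda>x. 1 / (x - \<bar>t\<bar>) ^ (N + 2)) \<in> O[at_top](\<lambda>x. 1 / x ^ (N + 2))"
    by (rule inverse_shift_bigo) simp
  also have "(\<lambda>x::real. 1 / x ^ (N + 2)) \<in> o[at_top](\<lambda>x. 1 / x ^ (N + 1))"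
    by (rule inverse_power_smallo) simp
  finally show ?thesis by (simp add: K_def lessThan_Suc_atMost)
qed

lemma asymp_expansion_shift:
  assumes "asymp_expansion f 0 (\<lambda>n. (-1) ^ n * a n)"
  shows "asymp_expansion (\<lambda>x. f (x + t)) 0 (\<lambda>n. (-1) ^ n * appell a n t)"
  unfolding asymp_expansion_def
proof (intro allI impI)
  fix N :: nat
  let ?g = "\<lambda>x::real. 1 / x ^ (N + 1)"
  let ?c = "\<lambda>n. (-1) ^ n * a n"
  let ?T = "\<lambda>n x. \<Sum>j\<le>N - n. (-1) ^ j * real ((n + j) choose n) * t ^ j / x ^ (n + j + 1)"
  have "filterlim (\<lambda>x. x + t) at_top at_top"
    using filterlim_tendsto_add_at_top[OF tendsto_const filterlim_ident, of t] by (simp add: add.commute)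
  moreover have "(\<lambda>x. f x - (\<Sum>n\<le>N. ?c n / x ^ (n + 1))) \<in> o[at_top](?g)"
    using assms by (simp add: asymp_expansion_def atMost_atLeast0)
  ultimately have "(\<lambda>x. f (x + t) - (\<Sum>n\<le>N. ?c n / (x + t) ^ (n + 1))) \<in> o[at_top](\<lambda>x. ?g (x + t))"
    by (rule landau_o.small.compose[rotated])
  also have "(\<lambda>x. ?g (x + t)) \<in> O[at_top](?g)"
    using inverse_shift_bigo[of "N + 1" "N + 1" "- t"] by simp
  finally have 1: "(\<lambda>x. f (x + t) - (\<Sum>n\<le>N. ?c n / (x + t) ^ (n + 1))) \<in> o[at_top](?g)" .
  have "(\<lambda>x. \<Sum>n\<le>N. ?c n * (1 / (x + t) ^ (n + 1) - ?T n x)) \<in> o[at_top](?g)"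
  proof (rule big_sum_in_smallo)
    fix n assume "n \<in> {..N}"
    then have "(\<lambda>x. 1 / (x + t) ^ (n + 1) - ?T n x) \<in> o[at_top](?g)"
      by (intro power_inverse_shift_smallo) simp
    then show "(\<lambda>x. ?c n * (1 / (x + t) ^ (n + 1) - ?T n x)) \<in> o[at_top](?g)"
      by (cases "?c n = 0") simp_all
  qed
  with 1 have "(\<lambda>x. f (x + t) - (\<Sum>n\<le>N. ?c n / (x + t) ^ (n + 1))
      + (\<Sum>n\<le>N. ?c n * (1 / (x + t) ^ (n + 1) - ?T n x))) \<in> o[at_top](?g)"
    by (rule sum_in_smallo)
  moreover have "(\<Sum>n\<le>N. ?c n * ?T n x) = (\<Sum>m\<le>N. (-1) ^ m * appell a m t / x ^ (m + 1))" for x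
  proof -
    let ?h = "\<lambda>n j. ?c n * ((-1) ^ j * real ((n + j) choose n) * t ^ j / x ^ (n + j + 1))"
    have "(\<Sum>n\<le>N. ?c n * ?T n x) = (\<Sum>(n, j)\<in>{(n, j). n + j \<le> N}. ?h n j)"
      unfolding sum_distrib_left sum.Sigma[OF finite_atMost ballI[OF finite_atMost]]
      by (rule sum.cong) auto
    also have "\<dots> = (\<Sum>m\<le>N. \<Sum>n\<le>m. ?h n (m - n))"
      by (rule sum.triangle_reindex_eq)
    also have "\<dots> = (\<Sum>m\<le>N. (-1) ^ m * appell a m t / x ^ (m + 1))"
      unfolding appell_def atMost_atLeast0 sum_distrib_left sum_divide_distrib
      by (intro sum.cong refl) (auto simp flip: power_add mult.assoc)
    finally show ?thesis .
  qed
  ultimately show "(\<lambda>x. f (x + t) - (\<Sum>n=0..N. (-1) ^ n * appell a n t / x ^ (n + 1))) \<in> o[at_top](?g)"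
    by (simp add: atMost_atLeast0 right_diff_distrib sum_subtractf)
qed

subsection \<open>Appell sequences\<close>

lemma binomial_absorb_comp_real:
  "real (n choose k) * real (n - k) = real n * real (n - 1 choose k)"
  using binomial_absorb_comp[of n k] by (metis mult.commute of_nat_mult)

lemma appell_has_derivative:
  "(appell a n has_real_derivative real n * appell a (n - 1) t) (at t)"
proof (cases n)
  case (Suc m)
  have "(appell a n has_real_derivative
      (\<Sum>k=0..n. real (n choose k) * a k * (real (n - k) * t ^ (n - k - 1)))) (at t)"
    unfolding appell_def[abs_def] by (auto intro!: derivative_eq_intros sum.cong)
  also have "(\<Sum>k=0..n. real (n choose k) * a k * (real (n - k) * t ^ (n - k - 1)))
      = (\<Sum>k=0..m. real (n choose k) * a k * (real (n - k) * t ^ (n - k - 1)))"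
    by (simp add: Suc)
  also have "\<dots> = real n * appell a (n - 1) t"
    unfolding appell_def sum_distrib_left
  proof (rule sum.cong)
    fix k
    have "real (n choose k) * a k * (real (n - k) * t ^ (n - k - 1))
        = (real (n choose k) * real (n - k)) * (a k * t ^ (n - 1 - k))"
      by (simp add: mult_ac)
    also have "\<dots> = (real n * real (n - 1 choose k)) * (a k * t ^ (n - 1 - k))"
      by (simp only: binomial_absorb_comp_real)
    finally show "real (n choose k) * a k * (real (n - k) * t ^ (n - k - 1))
        = real n * (real (n - 1 choose k) * a k * t ^ (n - 1 - k))"
      by (simp only: mult_ac)
  qed (simp add: Suc)
  finally show ?thesis .
qed (simp add: appell_def[abs_def])

lemma appell_add:
  "appell a n (t + h) = (\<Sum>j\<le>n. real (n choose j) * h ^ j * appell a (n - j) t)"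
proof -
  let ?g = "\<lambda>k j. real (n choose k) * a k * (real ((n - k) choose j) * h ^ j * t ^ (n - k - j))"
  have "appell a n (t + h) = (\<Sum>k\<le>n. \<Sum>j\<le>n - k. ?g k j)"
    by (simp add: appell_def atMost_atLeast0 add.commute[of t] binomial_ring sum_distrib_left)
  also have "\<dots> = (\<Sum>j\<le>n. \<Sum>k\<le>n - j. ?g k j)"
    unfolding sum.Sigma[OF finite_atMost ballI[OF finite_atMost]]
    by (rule sum.reindex_bij_witness[of _ prod.swap prod.swap]) auto
  also have "\<dots> = (\<Sum>j\<le>n. real (n choose j) * h ^ j * appell a (n - j) t)"
    unfolding appell_def atMost_atLeast0[symmetric] sum_distrib_left
  proof (intro sum.cong refl)
    fix j k assume "j \<in> {..n}" "k \<in> {..n - j}"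
    then have "(n choose k) * ((n - k) choose j) = (n choose j) * ((n - j) choose k)"
      using choose_mult[of k "k + j" n] choose_mult[of j "k + j" n] binomial_symmetric[of k "k + j"]
      by (simp add: add.commute)
    then have "real (n choose k) * real ((n - k) choose j) = real (n choose j) * real ((n - j) choose k)"
      by (simp flip: of_nat_mult)
    then show "?g k j = real (n choose j) * h ^ j * (real (n - j choose k) * a k * t ^ (n - j - k))"
      by (simp add: mult_ac add.commute[of k j])
  qed
  finally show ?thesis .
qed

lemma sum_even_terms:
  fixes g :: "nat \<Rightarrow> 'a::comm_monoid_add"
  assumes "\<And>j. odd j \<Longrightarrow> g j = 0"
  shows "(\<Sum>j\<le>n. g j) = (\<Sum>i\<le>n div 2. g (2 * i))"
proof -
  have "(\<Sum>i\<le>n div 2. g (2 * i)) = sum g ((*) 2 ` {..n div 2})"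
    by (subst sum.reindex) (auto simp: inj_on_def)
  also have "\<dots> = (\<Sum>j\<le>n. g j)"
  proof (rule sum.mono_neutral_left)
    show "\<forall>j\<in>{..n} - (*) 2 ` {..n div 2}. g j = 0"
    proof
      fix j assume j: "j \<in> {..n} - (*) 2 ` {..n div 2}"
      have "odd j"
      proof
        assume "even j"
        then obtain i where "j = 2 * i" ..
        with j show False by auto
      qed
      then show "g j = 0" by (rule assms)
    qed
  qed auto
  finally show ?thesis ..
qed

lemma appell_even_part:
  "appell a n (t + h) + appell a n (t - h)
    = 2 * (\<Sum>i\<le>n div 2. real (n choose (2 * i)) * (h\<^sup>2) ^ i * appell a (n - 2 * i) t)"
proof -
  have "appell a n (t + h) + appell a n (t - h)
      = (\<Sum>j\<le>n. real (n choose j) * (h ^ j + (- h) ^ j) * appell a (n - j) t)"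
    using appell_add[of a n t "- h"] appell_add[of a n t h] by (simp add: sum.distrib algebra_simps)
  also have "\<dots> = (\<Sum>i\<le>n div 2. real (n choose (2 * i)) * (h ^ (2 * i) + (- h) ^ (2 * i)) * appell a (n - 2 * i) t)"
    by (rule sum_even_terms) simp
  also have "\<dots> = 2 * (\<Sum>i\<le>n div 2. real (n choose (2 * i)) * (h\<^sup>2) ^ i * appell a (n - 2 * i) t)"
    unfolding sum_distrib_left by (intro sum.cong refl) (simp add: power_mult)
  finally show ?thesis .
qed

lemma appell_odd_part:
  "appell a (Suc m) (t + h) - appell a (Suc m) (t - h)
    = 2 * (real m + 1) * h *
      (\<Sum>i\<le>m div 2. 1 / (2 * real i + 1) * real (m choose (2 * i)) * (h\<^sup>2) ^ i * appell a (m - 2 * i) t)"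
proof -
  have "appell a (Suc m) (t + h) - appell a (Suc m) (t - h)
      = (\<Sum>j\<le>Suc m. real (Suc m choose j) * (h ^ j - (- h) ^ j) * appell a (Suc m - j) t)"
    using appell_add[of a "Suc m" t "- h"]
      appell_add[of a "Suc m" t h]
    by (simp add: sum_subtractf algebra_simps del: sum.atMost_Suc binomial_Suc_Suc)
  also have "\<dots> = (\<Sum>j\<le>m. real (Suc m choose Suc j) * (h ^ Suc j - (- h) ^ Suc j) * appell a (m - j) t)"
    by (subst sum.atMost_Suc_shift) simp
  also have "\<dots> = (\<Sum>i\<le>m div 2. real (Suc m choose Suc (2 * i)) * (h ^ Suc (2 * i) - (- h) ^ Suc (2 * i))
      * appell a (m - 2 * i) t)"
    by (rule sum_even_terms) simp
  also have "\<dots> = 2 * (real m + 1) * h *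
      (\<Sum>i\<le>m div 2. 1 / (2 * real i + 1) * real (m choose (2 * i)) * (h\<^sup>2) ^ i * appell a (m - 2 * i) t)"
    unfolding sum_distrib_left
  proof (intro sum.cong refl)
    fix i
    have "real (Suc (2 * i)) * real (Suc m choose Suc (2 * i)) = real (Suc m) * real (m choose (2 * i))"
      using Suc_times_binomial_eq[of m "2 * i"] by (metis mult.commute of_nat_mult)
    then have "real (Suc m choose Suc (2 * i)) = (real m + 1) * real (m choose (2 * i)) / (2 * real i + 1)"
      by (simp add: field_simps del: binomial_Suc_Suc)
    then show "real (Suc m choose Suc (2 * i)) * (h ^ Suc (2 * i) - (- h) ^ Suc (2 * i)) * appell a (m - 2 * i) t
        = 2 * (real m + 1) * h *
          (1 / (2 * real i + 1) * real (m choose (2 * i)) * (h\<^sup>2) ^ i * appell a (m - 2 * i) t)"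
      by (simp add: power_mult del: binomial_Suc_Suc)
  qed
  finally show ?thesis .
qed

lemma nabla_eq_sum:
  assumes "\<delta> \<ge> 0"
  shows "nabla a m \<alpha> (- \<delta>\<^sup>2) =
    (\<Sum>i\<le>m div 2. 1 / (2 * real i + 1) * real (m choose (2 * i)) * (\<delta>\<^sup>2) ^ i * appell a (m - 2 * i) \<alpha>)"
proof -
  define S where
    "S h = (\<Sum>i\<le>m div 2. 1 / (2 * real i + 1) * real (m choose (2 * i)) * (h\<^sup>2) ^ i * appell a (m - 2 * i) \<alpha>)"
    for h :: real
  have quot: "appell_quot a m \<alpha> h = S h" if "h > 0" for h
    using that appell_odd_part[of a m \<alpha> h] by (simp add: appell_quot_def S_def)
  show ?thesis
  proof (cases "\<delta> = 0")
    case True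
    have "\<forall>\<^sub>F h in at_right 0. appell_quot a m \<alpha> h = S h"
      using eventually_at_right_less[of 0] by eventually_elim (rule quot)
    then have "(S \<longlongrightarrow> nabla a m \<alpha> 0) (at_right 0)"
      by (rule Lim_transform_eventually[OF nabla_zero])
    moreover have "(S \<longlongrightarrow> S 0) (at_right 0)"
      unfolding S_def by (intro tendsto_intros)
    ultimately have "nabla a m \<alpha> 0 = S 0"
      by (rule tendsto_unique[OF trivial_limit_at_right_real])
    then show ?thesis using True by (simp add: S_def)
  next
    case False
    then show ?thesis
      using assms quot[of \<delta>] by (simp add: nabla_def S_def)
  qed
qed

lemma appell_lowering_sum:
  assumes "n \<ge> 1"
  shows "((\<lambda>t. \<Sum>i=k..n div 2. w i * real (n choose (2 * i)) * appell a (n - 2 * i) t) has_real_derivative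
    real n * (\<Sum>i=k..(n - 1) div 2. w i * real (n - 1 choose (2 * i)) * appell a (n - 1 - 2 * i) t)) (at t)"
proof (rule DERIV_cong)
  show "((\<lambda>t. \<Sum>i=k..n div 2. w i * real (n choose (2 * i)) * appell a (n - 2 * i) t) has_real_derivative
    (\<Sum>i=k..n div 2. w i * real (n choose (2 * i)) * (real (n - 2 * i) * appell a (n - 2 * i - 1) t))) (at t)"
    by (intro DERIV_sum DERIV_cmult appell_has_derivative)
  have "w i * real (n choose (2 * i)) * (real (n - 2 * i) * appell a (n - 2 * i - 1) t)
      = real n * (w i * real (n - 1 choose (2 * i)) * appell a (n - 1 - 2 * i) t)" for i
  proof -
    have "w i * real (n choose (2 * i)) * (real (n - 2 * i) * appell a (n - 2 * i - 1) t)
        = (real (n choose (2 * i)) * real (n - 2 * i)) * (w i * appell a (n - 1 - 2 * i) t)"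
      by (simp add: mult_ac)
    also have "\<dots> = (real n * real (n - 1 choose (2 * i))) * (w i * appell a (n - 1 - 2 * i) t)"
      by (simp only: binomial_absorb_comp_real)
    finally show ?thesis by (simp only: mult_ac)
  qed
  then have "(\<Sum>i=k..n div 2. w i * real (n choose (2 * i)) * (real (n - 2 * i) * appell a (n - 2 * i - 1) t))
      = (\<Sum>i=k..n div 2. real n * (w i * real (n - 1 choose (2 * i)) * appell a (n - 1 - 2 * i) t))"
    by (simp only:)
  also have "\<dots> = (\<Sum>i=k..(n - 1) div 2. real n * (w i * real (n - 1 choose (2 * i)) * appell a (n - 1 - 2 * i) t))"
  proof (rule sum.mono_neutral_right)
    show "\<forall>i\<in>{k..n div 2} - {k..(n - 1) div 2}.
        real n * (w i * real (n - 1 choose (2 * i)) * appell a (n - 1 - 2 * i) t) = 0"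
    proof
      fix i assume "i \<in> {k..n div 2} - {k..(n - 1) div 2}"
      then have "n - 1 < 2 * i" by auto
      then show "real n * (w i * real (n - 1 choose (2 * i)) * appell a (n - 1 - 2 * i) t) = 0"
        by (simp add: binomial_eq_0)
    qed
  qed auto
  finally show "(\<Sum>i=k..n div 2. w i * real (n choose (2 * i)) * (real (n - 2 * i) * appell a (n - 2 * i - 1) t))
      = real n * (\<Sum>i=k..(n - 1) div 2. w i * real (n - 1 choose (2 * i)) * appell a (n - 1 - 2 * i) t)"
    by (simp add: sum_distrib_left)
qed

lemma Delta_eq_second_difference:
  "Delta a n \<alpha> (- \<delta>\<^sup>2) = appell a n (\<alpha> + \<delta>) - 2 * appell a n \<alpha> + appell a n (\<alpha> - \<delta>)"
proof -
  have "{..n div 2} = insert 0 {1..n div 2}" by auto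
  then have "appell a n (\<alpha> + \<delta>) + appell a n (\<alpha> - \<delta>) = 2 * appell a n \<alpha> + Delta a n \<alpha> (- \<delta>\<^sup>2)"
    unfolding appell_even_part Delta_def by simp
  then show ?thesis by simp
qed

theorem proposition2p4:
  fixes f :: "real \<Rightarrow> real" and a :: "nat \<Rightarrow> real" and \<alpha> \<beta> \<delta> :: real
  assumes "asymp_expansion f 0 (\<lambda>n. (-1) ^ n * a n)"
    and "a 0 \<noteq> 0"
    and "\<delta> \<ge> 0"
    and "\<beta> = - \<delta>\<^sup>2"
  shows
    "(\<delta> \<noteq> 0 \<longrightarrow>
        asymp_expansion (\<lambda>x. (f (x + \<alpha> + \<delta>) - f (x + \<alpha> - \<delta>)) / (2 * \<delta>)) 1
          (\<lambda>n. - ((-1) ^ (n - 1) * real n * nabla a (n - 1) \<alpha> \<beta>))) \<and>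
     (\<forall>m. nabla a m \<alpha> \<beta> =
        (\<Sum>i=0..m div 2. 1 / (2 * real i + 1) * real (m choose (2 * i)) * (- \<beta>) ^ i
            * appell a (m - 2 * i) \<alpha>)) \<and>
     asymp_expansion (\<lambda>x. f (x + \<alpha> + \<delta>) - 2 * f (x + \<alpha>) + f (x + \<alpha> - \<delta>)) 2
       (\<lambda>n. (-1) ^ n * Delta a n \<alpha> \<beta>) \<and>
     Delta a 0 \<alpha> \<beta> = 0 \<and> Delta a 1 \<alpha> \<beta> = 0 \<and>
     (\<forall>m\<ge>1. ((\<lambda>t. nabla a m t \<beta>) has_real_derivative real m * nabla a (m - 1) \<alpha> \<beta>) (at \<alpha>)) \<and>
     (\<forall>n\<ge>1. ((\<lambda>t. Delta a n t \<beta>) has_real_derivative real n * Delta a (n - 1) \<alpha> \<beta>) (at \<alpha>))"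
proof (intro conjI impI allI)
  note shift = asymp_expansion_shift[OF assms(1)]
  note \<beta> = assms(4)
  have nabla: "nabla a m t \<beta> = (\<Sum>i=0..m div 2. 1 / (2 * real i + 1) * real (m choose (2 * i)) * (- \<beta>) ^ i
      * appell a (m - 2 * i) t)" for m t
    using nabla_eq_sum[OF assms(3)] by (simp add: \<beta> atMost_atLeast0)
  show "nabla a m \<alpha> \<beta> = (\<Sum>i=0..m div 2. 1 / (2 * real i + 1) * real (m choose (2 * i)) * (- \<beta>) ^ i
      * appell a (m - 2 * i) \<alpha>)" for m
    by (rule nabla)
  show "asymp_expansion (\<lambda>x. (f (x + \<alpha> + \<delta>) - f (x + \<alpha> - \<delta>)) / (2 * \<delta>)) 1
      (\<lambda>n. - ((-1) ^ (n - 1) * real n * nabla a (n - 1) \<alpha> \<beta>))" if "\<delta> \<noteq> 0"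
  proof -
    have pos: "\<delta> > 0" using that assms(3) by simp
    have coeff: "1 / (2 * \<delta>) * ((-1) ^ n * appell a n (\<alpha> + \<delta>)) + (- 1 / (2 * \<delta>)) * ((-1) ^ n * appell a n (\<alpha> - \<delta>))
        = - ((-1) ^ (n - 1) * real n * nabla a (n - 1) \<alpha> \<beta>)" for n
    proof (cases n)
      case (Suc m)
      have "real n * nabla a (n - 1) \<alpha> \<beta> = (appell a n (\<alpha> + \<delta>) - appell a n (\<alpha> - \<delta>)) / (2 * \<delta>)"
        unfolding \<beta> nabla_pos[OF pos] Suc by (simp add: divide_simps) (simp add: algebra_simps)
      then show ?thesis
        by (simp add: Suc mult.assoc diff_divide_distrib right_diff_distrib del: of_nat_Suc)
    qed (simp add: appell_def)
    have "asymp_expansion (\<lambda>x. (f (x + \<alpha> + \<delta>) - f (x + \<alpha> - \<delta>)) / (2 * \<delta>)) 0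
        (\<lambda>n. - ((-1) ^ (n - 1) * real n * nabla a (n - 1) \<alpha> \<beta>))"
      using asymp_expansion_lincomb[OF shift[of "\<alpha> + \<delta>"] shift[of "\<alpha> - \<delta>"], of "1 / (2 * \<delta>)" "- 1 / (2 * \<delta>)"]
      unfolding coeff by (simp add: diff_divide_distrib add.assoc add_diff_eq)
    then show ?thesis
      by (rule asymp_expansion_drop_zeros) simp
  qed
  show D01: "Delta a 0 \<alpha> \<beta> = 0" "Delta a 1 \<alpha> \<beta> = 0"
    by (simp_all add: Delta_def)
  show "asymp_expansion (\<lambda>x. f (x + \<alpha> + \<delta>) - 2 * f (x + \<alpha>) + f (x + \<alpha> - \<delta>)) 2
      (\<lambda>n. (-1) ^ n * Delta a n \<alpha> \<beta>)"
  proof (rule asymp_expansion_drop_zeros)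
    have "asymp_expansion (\<lambda>x. 1 * (1 * f (x + (\<alpha> + \<delta>)) + (- 2) * f (x + \<alpha>)) + 1 * f (x + (\<alpha> - \<delta>))) 0
        (\<lambda>n. 1 * (1 * ((-1) ^ n * appell a n (\<alpha> + \<delta>)) + (- 2) * ((-1) ^ n * appell a n \<alpha>))
          + 1 * ((-1) ^ n * appell a n (\<alpha> - \<delta>)))"
      by (intro asymp_expansion_lincomb shift)
    then show "asymp_expansion (\<lambda>x. f (x + \<alpha> + \<delta>) - 2 * f (x + \<alpha>) + f (x + \<alpha> - \<delta>)) 0
        (\<lambda>n. (-1) ^ n * Delta a n \<alpha> \<beta>)"
      by (simp add: \<beta> Delta_eq_second_difference algebra_simps)
    show "(-1) ^ n * Delta a n \<alpha> \<beta> = 0" if "n < 2" for n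
      using D01 that by (auto simp: less_2_cases_iff)
  qed
  show "((\<lambda>t. nabla a m t \<beta>) has_real_derivative real m * nabla a (m - 1) \<alpha> \<beta>) (at \<alpha>)" if "1 \<le> m" for m
    using appell_lowering_sum[OF that, where k = 0 and w = "\<lambda>i. 1 / (2 * real i + 1) * (- \<beta>) ^ i" and a = a and t = \<alpha>]
    by (simp add: nabla mult_ac)
  show "((\<lambda>t. Delta a n t \<beta>) has_real_derivative real n * Delta a (n - 1) \<alpha> \<beta>) (at \<alpha>)" if "1 \<le> n" for n
    using DERIV_cmult[OF appell_lowering_sum[OF that, where k = 1 and w = "\<lambda>i. (- \<beta>) ^ i" and a = a and t = \<alpha>], of 2]
    by (simp add: Delta_def mult_ac)
qed

end
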